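(* Let $a_1,a_2,a_3$ be three non-collinear non-null points such that the lines $a_1a_2$, $a_2a_3$, $a_1a_3$ are all non-null. Let $L$ be a non-null line, distinct from these three lines, which meets $a_2a_3$, $a_1a_3$ and $a_1a_2$ at non-null points $d_1$, $d_2$ and $d_3$ respectively. Define the quadrances $$r_1\equiv q(a_2,d_1),\quad t_1\equiv q(d_1,a_3),\quad r_2\equiv q(a_3,d_2),\quad t_2\equiv q(d_2,a_1),\quad r_3\equiv q(a_1,d_3),\quad t_3\equiv q(d_3,a_2).$$ Then $$r_1r_2r_3=t_1t_2t_3.$$
   Context: Let $\mathbb F$ be a field of characteristic not two. A 3-proportion $x:y:z$ is a triple of elements of $\mathbb F$, not all zero, up to a common non-zero scalar. A point $a=[x:y:z]$ and a line $L=(l:m:n)$ are both 3-proportions. The point $[x:y:z]$ lies on the line $(l:m:n)$ when $lx+my-nz=0$. For distinct points $a,b$, the join $ab$ is the unique line through both; distinct lines meet in the unique point lying on both. A point $[x:y:z]$ is null when $x^2+y^2-z^2=0$; a line $(l:m:n)$ is null when $l^2+m^2-n^2=0$. The quadrance between non-null points $a_1=[x_1:y_1:z_1]$, $a_2=[x_2:y_2:z_2]$ is $$q(a_1,a_2)=1-\frac{(x_1x_2+y_1y_2-z_1z_2)^2}{(x_1^2+y_1^2-z_1^2)(x_2^2+y_2^2-z_2^2)};$$ it is undefined if either point is null. *)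

theory Defs
  imports Complex_Main
begin

text \<open>
  A proportion \<open>x:y:z\<close> is an equivalence class of non-zero triples. The partial equivalence
  relation below does not relate the zero triple even to itself, so the quotient excludes it.
  Points and lines are both proportions.
\<close>

definition proportional :: "'a::field \<times> 'a \<times> 'a \<Rightarrow> 'a \<times> 'a \<times> 'a \<Rightarrow> bool" where
  "proportional = (\<lambda>(x, y, z) (x', y', z').
     (x, y, z) \<noteq> (0, 0, 0) \<and> (\<exists>c. c \<noteq> 0 \<and> x' = c * x \<and> y' = c * y \<and> z' = c * z))"

quotient_type (overloaded) 'a proportion = "'a::field \<times> 'a \<times> 'a" / partial: proportional
proof (rule part_equivpI)
  show "\<exists>t::'a \<times> 'a \<times> 'a. proportional t t"
    by (rule exI[of _ "(1, 0, 0)"]) (auto simp: proportional_def intro: exI[of _ 1])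
  show "symp (proportional :: 'a \<times> 'a \<times> 'a \<Rightarrow> _)"
  proof (rule sympI)
    fix s t :: "'a \<times> 'a \<times> 'a"
    assume "proportional s t"
    then obtain x y z c where "s = (x, y, z)" "s \<noteq> (0, 0, 0)" "c \<noteq> 0" "t = (c * x, c * y, c * z)"
      unfolding proportional_def by (cases s; cases t) auto
    then show "proportional t s"
      unfolding proportional_def by (auto intro!: exI[of _ "inverse c"])
  qed
  show "transp (proportional :: 'a \<times> 'a \<times> 'a \<Rightarrow> _)"
  proof (rule transpI)
    fix s t u :: "'a \<times> 'a \<times> 'a"
    assume st: "proportional s t" and tu: "proportional t u"
    from st obtain x y z c where "s = (x, y, z)" "s \<noteq> (0, 0, 0)" "c \<noteq> 0" "t = (c * x, c * y, c * z)"
      unfolding proportional_def by (cases s; cases t) auto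
    moreover from this tu obtain d where "d \<noteq> 0" "u = (d * (c * x), d * (c * y), d * (c * z))"
      unfolding proportional_def by (cases u) auto
    ultimately show "proportional s u"
      unfolding proportional_def by (auto intro!: exI[of _ "d * c"])
  qed
qed

type_synonym 'a point = "'a proportion"
type_synonym 'a line = "'a proportion"

lift_definition lies_on :: "'a::field point \<Rightarrow> 'a line \<Rightarrow> bool"
  is "\<lambda>(x, y, z) (l, m, n). l * x + m * y - n * z = 0"
proof -
  fix s s' t t' :: "'a \<times> 'a \<times> 'a"
  assume "proportional s s'" "proportional t t'"
  then obtain x y z c l m n d where
    *: "s = (x, y, z)" "s' = (c * x, c * y, c * z)" "c \<noteq> 0"
       "t = (l, m, n)" "t' = (d * l, d * m, d * n)" "d \<noteq> 0"
    unfolding proportional_def by (cases s; cases s'; cases t; cases t') auto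
  have "(d * l) * (c * x) + (d * m) * (c * y) - (d * n) * (c * z)
      = c * d * (l * x + m * y - n * z)"
    by (simp add: algebra_simps)
  then show "(case s of (x, y, z) \<Rightarrow> \<lambda>(l, m, n). l * x + m * y - n * z = 0) t
    = (case s' of (x, y, z) \<Rightarrow> \<lambda>(l, m, n). l * x + m * y - n * z = 0) t'"
    using * by (simp del: right_minus_eq)
qed

lift_definition null :: "'a::field proportion \<Rightarrow> bool"
  is "\<lambda>(x, y, z). x\<^sup>2 + y\<^sup>2 - z\<^sup>2 = 0"
proof -
  fix s s' :: "'a \<times> 'a \<times> 'a"
  assume "proportional s s'"
  then obtain x y z c where *: "s = (x, y, z)" "s' = (c * x, c * y, c * z)" "c \<noteq> 0"
    unfolding proportional_def by (cases s; cases s') auto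
  have "(c * x)\<^sup>2 + (c * y)\<^sup>2 - (c * z)\<^sup>2 = c\<^sup>2 * (x\<^sup>2 + y\<^sup>2 - z\<^sup>2)"
    by (simp add: algebra_simps power2_eq_square)
  then show "(case s of (x, y, z) \<Rightarrow> x\<^sup>2 + y\<^sup>2 - z\<^sup>2 = 0) = (case s' of (x, y, z) \<Rightarrow> x\<^sup>2 + y\<^sup>2 - z\<^sup>2 = 0)"
    using * by (simp del: right_minus_eq)
qed

text \<open>
  Only meaningful for non-null arguments; at a null point the denominator vanishes and
  division by zero yields a junk value.
\<close>

lift_definition quadrance :: "'a::field point \<Rightarrow> 'a point \<Rightarrow> 'a"
  is "\<lambda>(x\<^sub>1, y\<^sub>1, z\<^sub>1) (x\<^sub>2, y\<^sub>2, z\<^sub>2).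
        1 - (x\<^sub>1 * x\<^sub>2 + y\<^sub>1 * y\<^sub>2 - z\<^sub>1 * z\<^sub>2)\<^sup>2
            / ((x\<^sub>1\<^sup>2 + y\<^sub>1\<^sup>2 - z\<^sub>1\<^sup>2) * (x\<^sub>2\<^sup>2 + y\<^sub>2\<^sup>2 - z\<^sub>2\<^sup>2))"
proof -
  let ?q = "\<lambda>(x\<^sub>1, y\<^sub>1, z\<^sub>1) (x\<^sub>2, y\<^sub>2, z\<^sub>2).
        1 - (x\<^sub>1 * x\<^sub>2 + y\<^sub>1 * y\<^sub>2 - z\<^sub>1 * z\<^sub>2)\<^sup>2
            / ((x\<^sub>1\<^sup>2 + y\<^sub>1\<^sup>2 - z\<^sub>1\<^sup>2) * (x\<^sub>2\<^sup>2 + y\<^sub>2\<^sup>2 - z\<^sub>2\<^sup>2)) :: 'a"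
  fix s s' t t' :: "'a \<times> 'a \<times> 'a"
  assume "proportional s s'" "proportional t t'"
  then obtain x y z c l m n d where
    *: "s = (x, y, z)" "s' = (c * x, c * y, c * z)" "c \<noteq> 0"
       "t = (l, m, n)" "t' = (d * l, d * m, d * n)" "d \<noteq> 0"
    unfolding proportional_def by (cases s; cases s'; cases t; cases t') auto
  have "((c * x) * (d * l) + (c * y) * (d * m) - (c * z) * (d * n))\<^sup>2
      = (c\<^sup>2 * d\<^sup>2) * (x * l + y * m - z * n)\<^sup>2"
    by (simp add: algebra_simps power2_eq_square)
  moreover have "((c * x)\<^sup>2 + (c * y)\<^sup>2 - (c * z)\<^sup>2) * ((d * l)\<^sup>2 + (d * m)\<^sup>2 - (d * n)\<^sup>2)
      = (c\<^sup>2 * d\<^sup>2) * ((x\<^sup>2 + y\<^sup>2 - z\<^sup>2) * (l\<^sup>2 + m\<^sup>2 - n\<^sup>2))"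
    by (simp add: algebra_simps power2_eq_square)
  ultimately show "?q s t = ?q s' t'"
    using * by (simp del: right_minus_eq)
qed

lemma ex1_line_through:
  fixes a b :: "'a::field point"
  assumes "a \<noteq> b"
  shows "\<exists>!L. lies_on a L \<and> lies_on b L"
proof -
  have "\<exists>L. (lies_on a L \<and> lies_on b L) \<and> (\<forall>M. lies_on a M \<and> lies_on b M \<longrightarrow> M = L)"
    using assms
  proof transfer
    fix a b :: "'a \<times> 'a \<times> 'a"
    let ?on = "\<lambda>(x, y, z) (l, m, n). l * x + m * y - n * z = (0::'a)"
    assume aa: "proportional a a" and bb: "proportional b b" and ab: "\<not> proportional a b"
    obtain x y z x' y' z' where a: "a = (x, y, z)" and b: "b = (x', y', z')"
      by (metis prod_cases3)
    have a0: "x \<noteq> 0 \<or> y \<noteq> 0 \<or> z \<noteq> 0" and b0: "x' \<noteq> 0 \<or> y' \<noteq> 0 \<or> z' \<noteq> 0"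
      using aa bb by (auto simp: a b proportional_def)
    define l m n where "l = y * z' - z * y'" and "m = z * x' - x * z'" and "n = y * x' - x * y'"
    have nz: "l \<noteq> 0 \<or> m \<noteq> 0 \<or> n \<noteq> 0"
    proof (rule ccontr)
      assume "\<not> ?thesis"
      then have e: "y * z' = z * y'" "z * x' = x * z'" "y * x' = x * y'"
        by (auto simp: l_def m_def n_def)
      consider "x \<noteq> 0" | "x = 0" "y \<noteq> 0" | "x = 0" "y = 0" "z \<noteq> 0" using a0 by blast
      then have "\<exists>c. x' = c * x \<and> y' = c * y \<and> z' = c * z"
      proof cases
        case 1
        then show ?thesis using e by (intro exI[of _ "x' / x"]) (auto simp: field_simps)
      next
        case 2
        then show ?thesis using e by (intro exI[of _ "y' / y"]) (auto simp: field_simps)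
      next
        case 3
        then show ?thesis using e by (intro exI[of _ "z' / z"]) (auto simp: field_simps)
      qed
      then obtain c where c: "x' = c * x" "y' = c * y" "z' = c * z" by blast
      moreover have "c \<noteq> 0" using b0 c by auto
      ultimately have "proportional a b" using a0 by (auto simp: a b proportional_def)
      then show False using ab by simp
    qed
    have ex: "?on a (l, m, n)" "?on b (l, m, n)"
      by (simp_all add: a b l_def m_def n_def algebra_simps)
    have uniq: "proportional (p, q, r) (l, m, n)"
      if pqr: "proportional (p, q, r) (p, q, r)"
        and "p * x + q * y - r * z = 0" "p * x' + q * y' - r * z' = 0" for p q r
    proof -
      have o: "r * z = p * x + q * y" "r * z' = p * x' + q * y'" using that by auto
      have e: "p * m = q * l" "p * n = r * l" "q * n = r * m"
      proof -
        have "p * m - q * l = z * (p * x' + q * y') - z' * (p * x + q * y)"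
          by (simp add: m_def l_def algebra_simps)
        then show "p * m = q * l" by (simp add: o[symmetric])
        have "r * l = y * (r * z') - y' * (r * z)" by (simp add: l_def algebra_simps)
        also have "\<dots> = p * n" by (simp add: o n_def algebra_simps)
        finally show "p * n = r * l" ..
        have "r * m = x' * (r * z) - x * (r * z')" by (simp add: m_def algebra_simps)
        also have "\<dots> = q * n" by (simp add: o n_def algebra_simps)
        finally show "q * n = r * m" ..
      qed
      have p0: "p \<noteq> 0 \<or> q \<noteq> 0 \<or> r \<noteq> 0" using pqr by (auto simp: proportional_def)
      then consider "p \<noteq> 0" | "p = 0" "q \<noteq> 0" | "p = 0" "q = 0" "r \<noteq> 0" by blast
      then have "\<exists>c. l = c * p \<and> m = c * q \<and> n = c * r"
      proof cases
        case 1
        then show ?thesis using e by (intro exI[of _ "l / p"]) (auto simp: field_simps)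
      next
        case 2
        then show ?thesis using e by (intro exI[of _ "m / q"]) (auto simp: field_simps)
      next
        case 3
        then show ?thesis using e by (intro exI[of _ "n / r"]) (auto simp: field_simps)
      qed
      then obtain c where "l = c * p" "m = c * q" "n = c * r" by blast
      moreover from this have "c \<noteq> 0" using nz by auto
      ultimately show ?thesis using p0 by (auto simp: proportional_def)
    qed
    have lmn: "proportional (l, m, n) (l, m, n)"
      using nz by (auto simp: proportional_def intro: exI[of _ 1])
    show "\<exists>L\<in>Collect (\<lambda>x. proportional x x).
      (?on a L \<and> ?on b L) \<and>
      (\<forall>M\<in>Collect (\<lambda>x. proportional x x). ?on a M \<and> ?on b M \<longrightarrow> proportional M L)"
      using lmn ex uniq by (intro bexI[of _ "(l, m, n)"]) (auto simp: a b)
  qed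
  then show ?thesis by blast
qed

lemma lies_on_commute: "lies_on a L \<longleftrightarrow> lies_on L a"
  by transfer (auto simp: mult.commute)

lemma ex1_common_point: "L \<noteq> M \<Longrightarrow> \<exists>!a. lies_on a L \<and> lies_on a M"
  using ex1_line_through[of L M] by (simp add: lies_on_commute)

definition join :: "'a::field point \<Rightarrow> 'a point \<Rightarrow> 'a line" where
  "join a b = (THE L. lies_on a L \<and> lies_on b L)"

definition meet :: "'a::field line \<Rightarrow> 'a line \<Rightarrow> 'a point" where
  "meet L M = (THE a. lies_on a L \<and> lies_on a M)"

lemma lies_on_join:
  assumes "a \<noteq> b"
  shows "lies_on a (join a b)" "lies_on b (join a b)"
  using theI'[OF ex1_line_through[OF assms]] by (simp_all add: join_def)

lemma join_eqI: "a \<noteq> b \<Longrightarrow> lies_on a L \<Longrightarrow> lies_on b L \<Longrightarrow> join a b = L"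
  using ex1_line_through lies_on_join by blast

lemma lies_on_meet:
  assumes "L \<noteq> M"
  shows "lies_on (meet L M) L" "lies_on (meet L M) M"
  using theI'[OF ex1_common_point[OF assms]] by (simp_all add: meet_def)

lemma meet_eqI: "L \<noteq> M \<Longrightarrow> lies_on a L \<Longrightarrow> lies_on a M \<Longrightarrow> meet L M = a"
  using ex1_common_point lies_on_meet by blast

definition collinear :: "'a::field point set \<Rightarrow> bool" where
  "collinear A \<longleftrightarrow> (\<exists>L. \<forall>a\<in>A. lies_on a L)"

end

theory Submission
  imports Defs
begin

text \<open>
  Let \<open>v\<close>, \<open>u\<close> represent two vertices and let \<open>\<alpha>\<close>, \<open>\<beta>\<close> be the values at them of a linear functional
  defining \<open>L\<close>. The point of \<open>L\<close> on the join is represented by \<open>\<beta> v - \<alpha> u\<close>, so its quadrances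
  to the two vertices are \<open>\<alpha>\<^sup>2 k / Q(v)\<close> and \<open>\<beta>\<^sup>2 k / Q(u)\<close> with a common factor \<open>k\<close>, because the Gram
  determinant of \<open>v\<close> and \<open>\<beta> v - \<alpha> u\<close> is \<open>\<alpha>\<^sup>2\<close> times that of \<open>v\<close> and \<open>u\<close>. Multiplying around the
  triangle, both products contain the same factors.
\<close>

lemma proportional_refl_iff: "proportional v v \<longleftrightarrow> v \<noteq> (0, 0, 0)"
  unfolding proportional_def by (cases v) (simp add: exI[of _ 1])

lemma rep_proportion_nonzero: "rep_proportion a \<noteq> (0, 0, 0)"
  using Quotient3_rep_reflp[OF Quotient3_proportion] proportional_refl_iff by blast

lemma proportional_rep_imp_eq:
  "proportional (rep_proportion a) (rep_proportion b) \<Longrightarrow> a = b"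
  using Quotient3_rel_rep[OF Quotient3_proportion] by blast

text \<open>
  Only the vanishing of the next two values is intrinsic; the values themselves depend on the
  representatives picked by \<open>rep_proportion\<close>.
\<close>

definition qform :: "'a::field point \<Rightarrow> 'a" where
  "qform a = (case rep_proportion a of (x, y, z) \<Rightarrow> x\<^sup>2 + y\<^sup>2 - z\<^sup>2)"

definition incidence :: "'a::field line \<Rightarrow> 'a point \<Rightarrow> 'a" where
  "incidence L a = (case rep_proportion L of (l, m, n) \<Rightarrow>
     case rep_proportion a of (x, y, z) \<Rightarrow> l * x + m * y - n * z)"

lemma lies_on_iff_incidence: "lies_on a L \<longleftrightarrow> incidence L a = 0"
  by (simp add: lies_on.rep_eq incidence_def split: prod.splits)

lemma null_iff_qform: "null a \<longleftrightarrow> qform a = 0"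
  by (simp add: null.rep_eq qform_def split: prod.splits)

text \<open>Since neither point is null, 1 can be put over the common denominator; the numerator
  becomes the Gram determinant of the two representatives.\<close>

lemma quadrance_eq_gram:
  assumes "rep_proportion a = (x, y, z)" "rep_proportion b = (p, q, r)" "\<not> null a" "\<not> null b"
  shows "quadrance a b = (qform a * qform b - (x * p + y * q - z * r)\<^sup>2) / (qform a * qform b)"
  using assms by (simp add: null_iff_qform quadrance.rep_eq qform_def diff_divide_distrib)

text \<open>A point given by an explicit triple has a chosen representative that agrees with this
  triple only up to a scalar; \<open>c\<close> records that scalar.\<close>

lemma ex_rep_proportion:
  assumes "(x, y, z) \<noteq> (0, 0, 0)"
  obtains a c where "c \<noteq> 0" "rep_proportion a = (c * x, c * y, c * z)"
proof -
  let ?a = "abs_proportion (x, y, z)"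
  have "proportional (x, y, z) (rep_proportion ?a)"
    using Quotient3_rep_abs[OF Quotient3_proportion, of "(x, y, z)"] assms
      proportional_refl_iff[of "(x, y, z)"] proportion_equivp part_equivp_symp by metis
  then obtain c where "c \<noteq> 0" "rep_proportion ?a = (c * x, c * y, c * z)"
    unfolding proportional_def by (cases "rep_proportion ?a") auto
  then show ?thesis using that by blast
qed

lemma join_commute: "join a b = join b a"
  by (simp add: join_def conj_commute)

text \<open>Passing from the pair v, u to v, s v - t u is a linear substitution of determinant -t,
  so the Gram determinant is multiplied by the square of -t.\<close>

lemma gram_combination:
  fixes x y z p q r s t :: "'a::comm_ring_1"
  defines "X \<equiv> s * x - t * p" and "Y \<equiv> s * y - t * q" and "Z \<equiv> s * z - t * r"
  shows "(x\<^sup>2 + y\<^sup>2 - z\<^sup>2) * (X\<^sup>2 + Y\<^sup>2 - Z\<^sup>2) - (x * X + y * Y - z * Z)\<^sup>2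
    = t\<^sup>2 * ((x\<^sup>2 + y\<^sup>2 - z\<^sup>2) * (p\<^sup>2 + q\<^sup>2 - r\<^sup>2) - (x * p + y * q - z * r)\<^sup>2)"
proof -
  define A B C where "A = x\<^sup>2 + y\<^sup>2 - z\<^sup>2" and "B = p\<^sup>2 + q\<^sup>2 - r\<^sup>2" and "C = x * p + y * q - z * r"
  have "X\<^sup>2 + Y\<^sup>2 - Z\<^sup>2 = s\<^sup>2 * A - 2 * s * t * C + t\<^sup>2 * B"
    unfolding assms A_def B_def C_def by (simp add: algebra_simps power2_eq_square)
  moreover have "x * X + y * Y - z * Z = s * A - t * C"
    unfolding assms A_def C_def by (simp add: algebra_simps power2_eq_square)
  moreover have "A * (s\<^sup>2 * A - 2 * s * t * C + t\<^sup>2 * B) - (s * A - t * C)\<^sup>2 = t\<^sup>2 * (A * B - C\<^sup>2)"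
    by (simp add: algebra_simps power2_eq_square)
  ultimately show ?thesis by (simp add: A_def B_def C_def)
qed

text \<open>The factor \<open>k\<close> belongs to the side and is shared by its two endpoints;
  everything else refers to a single vertex, which is what lets the products around the triangle be
  compared.\<close>

lemma quadrance_meet_join:
  fixes a b :: "'a::field point" and L :: "'a line"
  assumes "a \<noteq> b" and L: "L \<noteq> join a b"
    and d: "d = meet L (join a b)" and null: "\<not> null a" "\<not> null b" "\<not> null d"
  obtains k where "quadrance a d = (incidence L a)\<^sup>2 * k / qform a"
    and "quadrance d b = (incidence L b)\<^sup>2 * k / qform b"
proof -
  define \<alpha> \<beta> where "\<alpha> = incidence L a" and "\<beta> = incidence L b"
  obtain x y z where a: "rep_proportion a = (x, y, z)" by (metis prod_cases3)
  obtain p q r where b: "rep_proportion b = (p, q, r)" by (metis prod_cases3)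
  obtain l m n where Lr: "rep_proportion L = (l, m, n)" by (metis prod_cases3)
  obtain f g h where Mr: "rep_proportion (join a b) = (f, g, h)" by (metis prod_cases3)
  have lm: "\<alpha> = l * x + m * y - n * z" "\<beta> = l * p + m * q - n * r"
    by (simp_all add: \<alpha>_def \<beta>_def incidence_def a b Lr)
  have M: "f * x + g * y - h * z = 0" "f * p + g * q - h * r = 0"
    using lies_on_join[OF \<open>a \<noteq> b\<close>] by (simp_all add: lies_on_iff_incidence incidence_def a b Mr)
  have a0: "(x, y, z) \<noteq> (0, 0, 0)" and b0: "(p, q, r) \<noteq> (0, 0, 0)"
    using rep_proportion_nonzero[of a] rep_proportion_nonzero[of b] by (simp_all add: a b)
  have lm0: "\<alpha> \<noteq> 0 \<or> \<beta> \<noteq> 0"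
    using L join_eqI[OF \<open>a \<noteq> b\<close>, of L] by (auto simp: \<alpha>_def \<beta>_def lies_on_iff_incidence)
  define X Y Z where XYZ: "X = \<beta> * x - \<alpha> * p" "Y = \<beta> * y - \<alpha> * q" "Z = \<beta> * z - \<alpha> * r"
  have w0: "(X, Y, Z) \<noteq> (0, 0, 0)"
  proof
    assume "(X, Y, Z) = (0, 0, 0)"
    then have e: "\<beta> * x = \<alpha> * p" "\<beta> * y = \<alpha> * q" "\<beta> * z = \<alpha> * r"
      by (simp_all add: XYZ)
    \<comment> \<open>If one of \<alpha>, \<beta> vanished, then \<open>e\<close> and the nonzero
      representatives would force the other to vanish too, against \<open>lm0\<close>.\<close>
    have ne: "\<alpha> \<noteq> 0" "\<beta> \<noteq> 0" using e lm0 a0 b0 by auto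
    have "proportional (x, y, z) (p, q, r)"
      unfolding proportional_def using a0 ne e
      by (auto intro!: exI[of _ "\<beta> / \<alpha>"] simp: field_simps)
    then have "a = b" using proportional_rep_imp_eq[of a b] by (simp add: a b)
    then show False using \<open>a \<noteq> b\<close> by simp
  qed
  obtain w c where w: "rep_proportion w = (c * X, c * Y, c * Z)"
    using ex_rep_proportion[OF w0] by blast
  have "incidence L w = c * (l * X + m * Y - n * Z)"
    by (simp add: incidence_def Lr w algebra_simps)
  also have "l * X + m * Y - n * Z = 0"
    by (simp add: XYZ lm algebra_simps)
  finally have "lies_on w L" by (simp add: lies_on_iff_incidence)
  moreover have "lies_on w (join a b)"
  proof -
    have "incidence (join a b) w
        = c * (\<beta> * (f * x + g * y - h * z) - \<alpha> * (f * p + g * q - h * r))"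
      by (simp add: incidence_def Mr w XYZ algebra_simps)
    then show ?thesis by (simp only: M lies_on_iff_incidence) simp
  qed
  ultimately have dw: "d = w" using meet_eqI[OF L] d by blast
  \<comment> \<open>The scalar \<open>c\<close> is absorbed into the coefficients, so that the
    representative of \<open>d\<close> is exactly of the form treated in
    \<open>gram_combination\<close>.\<close>
  define s t where st: "s = c * \<beta>" "t = c * \<alpha>"
  have rd: "rep_proportion d = (s * x - t * p, s * y - t * q, s * z - t * r)"
    by (simp add: dw w XYZ st algebra_simps)
  define W where "W = qform d"
  define G where "G = qform a * qform b - (x * p + y * q - z * r)\<^sup>2"
  have "quadrance a d = (qform a * W - (x * (s * x - t * p) + y * (s * y - t * q) - z * (s * z - t * r))\<^sup>2)
      / (qform a * W)"
    unfolding W_def by (rule quadrance_eq_gram[OF a rd null(1,3)])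
  also have "\<dots> = t\<^sup>2 * G / (qform a * W)"
    using gram_combination[of x y z s t p q r] by (simp add: W_def G_def qform_def a b rd)
  finally have 1: "quadrance a d = \<alpha>\<^sup>2 * (c\<^sup>2 * G / W) / qform a"
    by (simp add: st power_mult_distrib mult_ac)
  have "quadrance d b = (W * qform b - ((s * x - t * p) * p + (s * y - t * q) * q - (s * z - t * r) * r)\<^sup>2)
      / (W * qform b)"
    unfolding W_def by (rule quadrance_eq_gram[OF rd b null(3,2)])
  \<comment> \<open>Seen from \<open>b\<close>, the same vector is (-t) u - (-s) v, with v, u
    representing \<open>a\<close>, \<open>b\<close>; the roles are exchanged and the factor is the
    square of -s.\<close>
  also have "\<dots> = s\<^sup>2 * G / (W * qform b)"
    using gram_combination[of p q r "- t" "- s" x y z]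
    by (simp add: W_def G_def qform_def a b rd mult.commute)
  finally have 2: "quadrance d b = \<beta>\<^sup>2 * (c\<^sup>2 * G / W) / qform b"
    by (simp add: st power_mult_distrib mult_ac)
  show ?thesis by (rule that[OF 1[unfolded \<alpha>_def] 2[unfolded \<beta>_def]])
qed

theorem theorem76:
  fixes a\<^sub>1 a\<^sub>2 a\<^sub>3 d\<^sub>1 d\<^sub>2 d\<^sub>3 :: "'a::field point" and L :: "'a line"
    and r\<^sub>1 r\<^sub>2 r\<^sub>3 t\<^sub>1 t\<^sub>2 t\<^sub>3 :: 'a
  assumes "CHAR('a) \<noteq> 2"
    and "\<not> null a\<^sub>1" "\<not> null a\<^sub>2" "\<not> null a\<^sub>3"
    and "\<not> collinear {a\<^sub>1, a\<^sub>2, a\<^sub>3}"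
    and "\<not> null (join a\<^sub>1 a\<^sub>2)" "\<not> null (join a\<^sub>2 a\<^sub>3)" "\<not> null (join a\<^sub>1 a\<^sub>3)"
    and "\<not> null L"
    and "L \<noteq> join a\<^sub>1 a\<^sub>2" "L \<noteq> join a\<^sub>2 a\<^sub>3" "L \<noteq> join a\<^sub>1 a\<^sub>3"
    and "d\<^sub>1 = meet L (join a\<^sub>2 a\<^sub>3)" "d\<^sub>2 = meet L (join a\<^sub>1 a\<^sub>3)" "d\<^sub>3 = meet L (join a\<^sub>1 a\<^sub>2)"
    and "\<not> null d\<^sub>1" "\<not> null d\<^sub>2" "\<not> null d\<^sub>3"
    and "r\<^sub>1 = quadrance a\<^sub>2 d\<^sub>1" "t\<^sub>1 = quadrance d\<^sub>1 a\<^sub>3"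
    and "r\<^sub>2 = quadrance a\<^sub>3 d\<^sub>2" "t\<^sub>2 = quadrance d\<^sub>2 a\<^sub>1"
    and "r\<^sub>3 = quadrance a\<^sub>1 d\<^sub>3" "t\<^sub>3 = quadrance d\<^sub>3 a\<^sub>2"
  shows "r\<^sub>1 * r\<^sub>2 * r\<^sub>3 = t\<^sub>1 * t\<^sub>2 * t\<^sub>3"
proof -
  \<comment> \<open>Points and lines have the same type, so \<open>L\<close> and \<open>join a\<^sub>1 a\<^sub>2\<close> also serve as two distinct points.\<close>
  have collinear: "collinear {a, b}" for a b :: "'a point"
  proof -
    obtain e where "a \<noteq> e" "b = a \<or> b = e"
      using assms(10) by (cases "a = b") metis+
    then show ?thesis
      using lies_on_join[of a e] unfolding collinear_def by auto
  qed
  \<comment> \<open>If two vertices coincided, the three would form a set of at most two points,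
    hence a collinear one.\<close>
  then have ne: "a\<^sub>2 \<noteq> a\<^sub>3" "a\<^sub>3 \<noteq> a\<^sub>1" "a\<^sub>1 \<noteq> a\<^sub>2"
    using assms(5) by (metis insert_absorb2 insert_commute)+
  obtain k\<^sub>1 where k\<^sub>1: "quadrance a\<^sub>2 d\<^sub>1 = (incidence L a\<^sub>2)\<^sup>2 * k\<^sub>1 / qform a\<^sub>2"
      "quadrance d\<^sub>1 a\<^sub>3 = (incidence L a\<^sub>3)\<^sup>2 * k\<^sub>1 / qform a\<^sub>3"
    by (rule quadrance_meet_join[OF ne(1) assms(11,13,3,4,16)])
  obtain k\<^sub>2 where k\<^sub>2: "quadrance a\<^sub>3 d\<^sub>2 = (incidence L a\<^sub>3)\<^sup>2 * k\<^sub>2 / qform a\<^sub>3"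
      "quadrance d\<^sub>2 a\<^sub>1 = (incidence L a\<^sub>1)\<^sup>2 * k\<^sub>2 / qform a\<^sub>1"
    by (rule quadrance_meet_join[OF ne(2) assms(12,14)[unfolded join_commute[of a\<^sub>1 a\<^sub>3]] assms(4,2,17)])
  obtain k\<^sub>3 where k\<^sub>3: "quadrance a\<^sub>1 d\<^sub>3 = (incidence L a\<^sub>1)\<^sup>2 * k\<^sub>3 / qform a\<^sub>1"
      "quadrance d\<^sub>3 a\<^sub>2 = (incidence L a\<^sub>2)\<^sup>2 * k\<^sub>3 / qform a\<^sub>2"
    by (rule quadrance_meet_join[OF ne(3) assms(10,15,2,3,18)])
  \<comment> \<open>Each vertex lies on two sides and contributes one factor to each product, so
    both sides are the same fraction up to the order of factors.\<close>
  show ?thesis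
    unfolding assms(19-24) k\<^sub>1 k\<^sub>2 k\<^sub>3 times_divide_times_eq by (simp only: mult_ac)
qed

end
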